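(* System $\mathsf{SKSq}$ and system $\mathsf{SKSgq}$ are strongly equivalent. Also, system $\mathsf{KSq}$ and system $\mathsf{KSgq}$ are strongly equivalent.
   Context: First-order terms are as usual; atoms are expressions $p(t_1,\dots,t_n)$ with $p$ a predicate symbol of arity $n$, and the negation of an atom is again an atom. Structures: $S ::= \mathsf f \mid \mathsf t \mid a \mid [S,\dots,S] \mid (S,\dots,S) \mid \bar S \mid \exists x S \mid \forall x S$ (non-empty lists), with $[\cdot]$ disjunction, $(\cdot)$ conjunction, $\bar S$ negation. A context $S\{\ \}$ is a structure with one occurrence of a hole, not in the scope of a negation; $S\{R\}$ fills the hole with $R$ (quantifiers of $S$ may capture variables of $R$); $S[R,T]$ abbreviates $S\{[R,T]\}$, $S(R,T)$ abbreviates $S\{(R,T)\}$. $R[x/t]$ denotes substitution of the term $t$ for $x$ in $R$, where $t$ must be free for $x$ in $R$. Equivalent structures are not distinguished; equivalence is the smallest equivalence relation induced by: $[\vec R,[\vec T],\vec U]=[\vec R,\vec T,\vec U]$, $(\vec R,(\vec T),\vec U)=(\vec R,\vec T,\vec U)$ ($\vec T$ non-empty); $[R,T]=[T,R]$, $(R,T)=(T,R)$; $(\mathsf f,\mathsf f)=\mathsf f$, $[\mathsf f,R]=R$, $[\mathsf t,\mathsf t]=\mathsf t$, $(\mathsf t,R)=R$; $\bar{\mathsf f}=\mathsf t$, $\bar{\mathsf t}=\mathsf f$, $\overline{[R,T]}=(\bar R,\bar T)$, $\overline{(R,T)}=[\bar R,\bar T]$, $\bar{\bar R}=R$, $\overline{\exists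 xR}=\forall x\bar R$, $\overline{\forall xR}=\exists x\bar R$; $\forall xR=\forall yR[x/y]$ and $\exists xR=\exists yR[x/y]$ if $y$ is not free in $R$; $\forall yR=\exists yR=R$ if $y$ is not free in $R$; and closure: if $R=T$ then $S\{R\}=S\{T\}$ and $\bar R=\bar T$. A derivation in a system (set of inference rules) is a finite sequence of rule instances, read top-down, the conclusion of each being the premise of the next; it may consist of a single structure. Its premise is the topmost structure, its conclusion the bottommost. Rules (written $\frac{\text{premise}}{\text{conclusion}}$; $a$ an atom, $R,T,U,V$ structures): $i{\downarrow}:\frac{S\{\mathsf t\}}{S[R,\bar R]}$, $i{\uparrow}:\frac{S(R,\bar R)}{S\{\mathsf f\}}$, $w{\downarrow}:\frac{S\{\mathsf f\}}{S\{R\}}$, $w{\uparrow}:\frac{S\{R\}}{S\{\mathsf t\}}$, $c{\downarrow}:\frac{S[R,R]}{S\{R\}}$, $c{\uparrow}:\frac{S\{R\}}{S(R,R)}$; $ai{\downarrow},ai{\uparrow},aw{\downarrow},aw{\uparrow},ac{\downarrow},ac{\uparrow}$ are these six rules respectively with $R$ restricted to be an atom $a$; $s:\frac{S([R,U],T)}{S[(R,T),U]}$, $m:\frac{S[(R,U),(T,V)]}{S([R,T],[U,V])}$, $u{\downarrow}:\frac{S\{\forall x[R,T]\}}{S[\forall xR,\exists xT]}$, $u{\uparrow}:\frac{S(\exists xR,\forall xT)}{S\{\exists x(R,T)\}}$, $n{\downarrow}:\frac{S\{R[x/t]\}}{S\{\exists xR\}}$, $n{\uparrow}:\frac{S\{\forall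 xR\}}{S\{R[x/t]\}}$, $l_1{\downarrow}:\frac{S[\exists xR,\exists xT]}{S\{\exists x[R,T]\}}$, $l_1{\uparrow}:\frac{S\{\forall x(R,T)\}}{S(\forall xR,\forall xT)}$, $l_2{\downarrow}:\frac{S[\forall xR,\forall xT]}{S\{\forall x[R,T]\}}$, $l_2{\uparrow}:\frac{S\{\exists x(R,T)\}}{S(\exists xR,\exists xT)}$. Systems: $\mathsf{SKSgq}=\{i{\downarrow},i{\uparrow},s,w{\downarrow},w{\uparrow},c{\downarrow},c{\uparrow},u{\downarrow},u{\uparrow},n{\downarrow},n{\uparrow}\}$; $\mathsf{KSgq}=\{i{\downarrow},s,w{\downarrow},c{\downarrow},u{\downarrow},n{\downarrow}\}$; $\mathsf{SKSq}=\{ai{\downarrow},ai{\uparrow},s,m,aw{\downarrow},aw{\uparrow},ac{\downarrow},ac{\uparrow},u{\downarrow},u{\uparrow},l_1{\downarrow},l_1{\uparrow},l_2{\downarrow},l_2{\uparrow},n{\downarrow},n{\uparrow}\}$; $\mathsf{KSq}=\{ai{\downarrow},s,m,aw{\downarrow},ac{\downarrow},u{\downarrow},l_1{\downarrow},l_2{\downarrow},n{\downarrow}\}$. Two systems $\mathcal S,\mathcal S'$ are strongly equivalent if for every derivation in $\mathcal S$ with premise $T$ and conclusion $R$ there is a derivation in $\mathcal S'$ with premise $T$ and conclusion $R$, and vice versa. *)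

theory Defs
  imports Main
begin

type_synonym var = nat

datatype 'f fo_term = Var var | Fun 'f "'f fo_term list"

text \<open>Arities are partial so that signatures without function symbols, or without
  predicate symbols, are covered as well.\<close>

record ('f, 'p) signature =
  fun_arity :: "'f \<Rightarrow> nat option"
  pred_arity :: "'p \<Rightarrow> nat option"

datatype ('f, 'p) struct =
    FF
  | TT
  | Atm 'p "'f fo_term list"
  | Disj "('f, 'p) struct list"
  | Conj "('f, 'p) struct list"
  | Neg "('f, 'p) struct"
  | Exi var "('f, 'p) struct"
  | Uni var "('f, 'p) struct"

fun wf_term :: "('f, 'p) signature \<Rightarrow> 'f fo_term \<Rightarrow> bool" where
  "wf_term \<Sigma> (Var x) \<longleftrightarrow> True"
| "wf_term \<Sigma> (Fun f ts) \<longleftrightarrow>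
     fun_arity \<Sigma> f = Some (length ts) \<and> (\<forall>t\<in>set ts. wf_term \<Sigma> t)"

text \<open>The structures over \<open>\<Sigma>\<close> are the raw structures satisfying \<open>wf_struct \<Sigma>\<close>:
  symbols are used with their arities, and lists are non-empty.\<close>

fun wf_struct :: "('f, 'p) signature \<Rightarrow> ('f, 'p) struct \<Rightarrow> bool" where
  "wf_struct \<Sigma> FF \<longleftrightarrow> True"
| "wf_struct \<Sigma> TT \<longleftrightarrow> True"
| "wf_struct \<Sigma> (Atm p ts) \<longleftrightarrow>
     pred_arity \<Sigma> p = Some (length ts) \<and> (\<forall>t\<in>set ts. wf_term \<Sigma> t)"
| "wf_struct \<Sigma> (Disj Rs) \<longleftrightarrow> Rs \<noteq> [] \<and> (\<forall>R\<in>set Rs. wf_struct \<Sigma> R)"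
| "wf_struct \<Sigma> (Conj Rs) \<longleftrightarrow> Rs \<noteq> [] \<and> (\<forall>R\<in>set Rs. wf_struct \<Sigma> R)"
| "wf_struct \<Sigma> (Neg R) \<longleftrightarrow> wf_struct \<Sigma> R"
| "wf_struct \<Sigma> (Exi x R) \<longleftrightarrow> wf_struct \<Sigma> R"
| "wf_struct \<Sigma> (Uni x R) \<longleftrightarrow> wf_struct \<Sigma> R"

inductive is_atom :: "('f, 'p) struct \<Rightarrow> bool" where
  "is_atom (Atm p ts)"
| "is_atom a \<Longrightarrow> is_atom (Neg a)"

fun vars_term :: "'f fo_term \<Rightarrow> var set" where
  "vars_term (Var x) = {x}"
| "vars_term (Fun f ts) = \<Union> (vars_term ` set ts)"

fun free_vars :: "('f, 'p) struct \<Rightarrow> var set" where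
  "free_vars FF = {}"
| "free_vars TT = {}"
| "free_vars (Atm p ts) = \<Union> (vars_term ` set ts)"
| "free_vars (Disj Rs) = \<Union> (free_vars ` set Rs)"
| "free_vars (Conj Rs) = \<Union> (free_vars ` set Rs)"
| "free_vars (Neg R) = free_vars R"
| "free_vars (Exi x R) = free_vars R - {x}"
| "free_vars (Uni x R) = free_vars R - {x}"

primrec subst_term :: "var \<Rightarrow> 'f fo_term \<Rightarrow> 'f fo_term \<Rightarrow> 'f fo_term" where
  "subst_term x t (Var y) = (if y = x then t else Var y)"
| "subst_term x t (Fun f ts) = Fun f (map (subst_term x t) ts)"

text \<open>\<open>subst x t R\<close> is \<open>R[x/t]\<close>. It does not rename bound variables and is only ever used
  together with the side condition \<open>free_for t x R\<close>.\<close>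

primrec subst :: "var \<Rightarrow> 'f fo_term \<Rightarrow> ('f, 'p) struct \<Rightarrow> ('f, 'p) struct" where
  "subst x t FF = FF"
| "subst x t TT = TT"
| "subst x t (Atm p ts) = Atm p (map (subst_term x t) ts)"
| "subst x t (Disj Rs) = Disj (map (subst x t) Rs)"
| "subst x t (Conj Rs) = Conj (map (subst x t) Rs)"
| "subst x t (Neg R) = Neg (subst x t R)"
| "subst x t (Exi y R) = Exi y (if y = x then R else subst x t R)"
| "subst x t (Uni y R) = Uni y (if y = x then R else subst x t R)"

fun free_for :: "'f fo_term \<Rightarrow> var \<Rightarrow> ('f, 'p) struct \<Rightarrow> bool" where
  "free_for t x FF \<longleftrightarrow> True"
| "free_for t x TT \<longleftrightarrow> True"
| "free_for t x (Atm p ts) \<longleftrightarrow> True"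
| "free_for t x (Disj Rs) \<longleftrightarrow> (\<forall>R\<in>set Rs. free_for t x R)"
| "free_for t x (Conj Rs) \<longleftrightarrow> (\<forall>R\<in>set Rs. free_for t x R)"
| "free_for t x (Neg R) \<longleftrightarrow> free_for t x R"
| "free_for t x (Exi y R) \<longleftrightarrow>
     x \<in> free_vars (Exi y R) \<longrightarrow> y \<notin> vars_term t \<and> free_for t x R"
| "free_for t x (Uni y R) \<longleftrightarrow>
     x \<in> free_vars (Uni y R) \<longrightarrow> y \<notin> vars_term t \<and> free_for t x R"

text \<open>There is no constructor for negation: the hole is never in the scope of one.\<close>

datatype ('f, 'p) ctxt =
    Hole
  | CDisj "('f, 'p) struct list" "('f, 'p) ctxt" "('f, 'p) struct list"
  | CConj "('f, 'p) struct list" "('f, 'p) ctxt" "('f, 'p) struct list"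
  | CExi var "('f, 'p) ctxt"
  | CUni var "('f, 'p) ctxt"

primrec fill :: "('f, 'p) ctxt \<Rightarrow> ('f, 'p) struct \<Rightarrow> ('f, 'p) struct" where
  "fill Hole R = R"
| "fill (CDisj Us S Vs) R = Disj (Us @ fill S R # Vs)"
| "fill (CConj Us S Vs) R = Conj (Us @ fill S R # Vs)"
| "fill (CExi x S) R = Exi x (fill S R)"
| "fill (CUni x S) R = Uni x (fill S R)"

inductive equivalent :: "('f, 'p) struct \<Rightarrow> ('f, 'p) struct \<Rightarrow> bool" (infix "\<approx>" 50) where
  refl: "R \<approx> R"
| sym: "R \<approx> T \<Longrightarrow> T \<approx> R"
| trans: "R \<approx> T \<Longrightarrow> T \<approx> U \<Longrightarrow> R \<approx> U"
| disj_assoc: "Ts \<noteq> [] \<Longrightarrow> Disj (Rs @ [Disj Ts] @ Us) \<approx> Disj (Rs @ Ts @ Us)"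
| conj_assoc: "Ts \<noteq> [] \<Longrightarrow> Conj (Rs @ [Conj Ts] @ Us) \<approx> Conj (Rs @ Ts @ Us)"
| disj_comm: "Disj [R, T] \<approx> Disj [T, R]"
| conj_comm: "Conj [R, T] \<approx> Conj [T, R]"
| conj_FF: "Conj [FF, FF] \<approx> FF"
| disj_FF: "Disj [FF, R] \<approx> R"
| disj_TT: "Disj [TT, TT] \<approx> TT"
| conj_TT: "Conj [TT, R] \<approx> R"
| neg_FF: "Neg FF \<approx> TT"
| neg_TT: "Neg TT \<approx> FF"
| neg_disj: "Neg (Disj [R, T]) \<approx> Conj [Neg R, Neg T]"
| neg_conj: "Neg (Conj [R, T]) \<approx> Disj [Neg R, Neg T]"
| neg_neg: "Neg (Neg R) \<approx> R"
| neg_exi: "Neg (Exi x R) \<approx> Uni x (Neg R)"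
| neg_uni: "Neg (Uni x R) \<approx> Exi x (Neg R)"
| rename_uni: "y \<notin> free_vars R \<Longrightarrow> free_for (Var y) x R \<Longrightarrow> Uni x R \<approx> Uni y (subst x (Var y) R)"
| rename_exi: "y \<notin> free_vars R \<Longrightarrow> free_for (Var y) x R \<Longrightarrow> Exi x R \<approx> Exi y (subst x (Var y) R)"
| vacuous_uni: "y \<notin> free_vars R \<Longrightarrow> Uni y R \<approx> R"
| vacuous_exi: "y \<notin> free_vars R \<Longrightarrow> Exi y R \<approx> R"
| ctxt: "R \<approx> T \<Longrightarrow> fill S R \<approx> fill S T"
| neg: "R \<approx> T \<Longrightarrow> Neg R \<approx> Neg T"

text \<open>Being a structure over \<open>\<Sigma>\<close> is invariant under equivalence, so it does not matter that
  the metavariables in the equations above range over raw structures.\<close>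

lemma wf_subst_term:
  "wf_term \<Sigma> (subst_term x (Var y) t) = wf_term \<Sigma> t"
  by (induction t) auto

lemma wf_subst:
  "wf_struct \<Sigma> (subst x (Var y) R) = wf_struct \<Sigma> R"
  by (induction R) (auto simp: wf_subst_term)

lemma wf_fill_cong:
  "wf_struct \<Sigma> R = wf_struct \<Sigma> T \<Longrightarrow> wf_struct \<Sigma> (fill S R) = wf_struct \<Sigma> (fill S T)"
  by (induction S) auto

lemma equivalent_wf:
  "R \<approx> T \<Longrightarrow> wf_struct \<Sigma> R = wf_struct \<Sigma> T"
proof (induction rule: equivalent.induct)
  case (ctxt R T S)
  show ?case by (rule wf_fill_cong) (rule ctxt.IH)
qed (auto simp: wf_subst)

text \<open>A rule is given by the pairs of premise and conclusion it relates inside the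
  context \<open>S{ }\<close>; the context and the passage to equivalent structures are added in
  \<open>rule_instance\<close>.\<close>

type_synonym ('f, 'p) rule = "(('f, 'p) struct \<times> ('f, 'p) struct) set"

definition i_down :: "('f, 'p) rule" where
  "i_down = {(TT, Disj [R, Neg R]) | R. True}"

definition i_up :: "('f, 'p) rule" where
  "i_up = {(Conj [R, Neg R], FF) | R. True}"

definition w_down :: "('f, 'p) rule" where
  "w_down = {(FF, R) | R. True}"

definition w_up :: "('f, 'p) rule" where
  "w_up = {(R, TT) | R. True}"

definition c_down :: "('f, 'p) rule" where
  "c_down = {(Disj [R, R], R) | R. True}"

definition c_up :: "('f, 'p) rule" where
  "c_up = {(R, Conj [R, R]) | R. True}"

definition ai_down :: "('f, 'p) rule" where
  "ai_down = {(TT, Disj [a, Neg a]) | a. is_atom a}"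

definition ai_up :: "('f, 'p) rule" where
  "ai_up = {(Conj [a, Neg a], FF) | a. is_atom a}"

definition aw_down :: "('f, 'p) rule" where
  "aw_down = {(FF, a) | a. is_atom a}"

definition aw_up :: "('f, 'p) rule" where
  "aw_up = {(a, TT) | a. is_atom a}"

definition ac_down :: "('f, 'p) rule" where
  "ac_down = {(Disj [a, a], a) | a. is_atom a}"

definition ac_up :: "('f, 'p) rule" where
  "ac_up = {(a, Conj [a, a]) | a. is_atom a}"

definition s_rule :: "('f, 'p) rule" where
  "s_rule = {(Conj [Disj [R, U], T], Disj [Conj [R, T], U]) | R T U. True}"

definition m_rule :: "('f, 'p) rule" where
  "m_rule = {(Disj [Conj [R, U], Conj [T, V]], Conj [Disj [R, T], Disj [U, V]]) | R T U V. True}"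

definition u_down :: "('f, 'p) rule" where
  "u_down = {(Uni x (Disj [R, T]), Disj [Uni x R, Exi x T]) | x R T. True}"

definition u_up :: "('f, 'p) rule" where
  "u_up = {(Conj [Exi x R, Uni x T], Exi x (Conj [R, T])) | x R T. True}"

definition n_down :: "('f, 'p) rule" where
  "n_down = {(subst x t R, Exi x R) | x t R. free_for t x R}"

definition n_up :: "('f, 'p) rule" where
  "n_up = {(Uni x R, subst x t R) | x t R. free_for t x R}"

definition l1_down :: "('f, 'p) rule" where
  "l1_down = {(Disj [Exi x R, Exi x T], Exi x (Disj [R, T])) | x R T. True}"

definition l1_up :: "('f, 'p) rule" where
  "l1_up = {(Uni x (Conj [R, T]), Conj [Uni x R, Uni x T]) | x R T. True}"

definition l2_down :: "('f, 'p) rule" where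
  "l2_down = {(Disj [Uni x R, Uni x T], Uni x (Disj [R, T])) | x R T. True}"

definition l2_up :: "('f, 'p) rule" where
  "l2_up = {(Exi x (Conj [R, T]), Conj [Exi x R, Exi x T]) | x R T. True}"

type_synonym ('f, 'p) system = "('f, 'p) rule set"

definition SKSgq :: "('f, 'p) system" where
  "SKSgq = {i_down, i_up, s_rule, w_down, w_up, c_down, c_up, u_down, u_up, n_down, n_up}"

definition KSgq :: "('f, 'p) system" where
  "KSgq = {i_down, s_rule, w_down, c_down, u_down, n_down}"

definition SKSq :: "('f, 'p) system" where
  "SKSq = {ai_down, ai_up, s_rule, m_rule, aw_down, aw_up, ac_down, ac_up, u_down, u_up,
     l1_down, l1_up, l2_down, l2_up, n_down, n_up}"

definition KSq :: "('f, 'p) system" where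
  "KSq = {ai_down, s_rule, m_rule, aw_down, ac_down, u_down, l1_down, l2_down, n_down}"

definition rule_instance ::
  "('f, 'p) rule \<Rightarrow> ('f, 'p) struct \<Rightarrow> ('f, 'p) struct \<Rightarrow> bool" where
  "rule_instance \<rho> P Q \<longleftrightarrow> (\<exists>S p q. (p, q) \<in> \<rho> \<and> P \<approx> fill S p \<and> fill S q \<approx> Q)"

text \<open>A derivation is represented by the list of structures occurring in it, from top to
  bottom; a one-element list is the derivation without rule instances. All entries are
  structures over \<open>\<Sigma>\<close>, which by \<open>equivalent_wf\<close> confines all rule instances to \<open>\<Sigma>\<close>.
  (In \<open>n_down\<close> and \<open>n_up\<close> the term \<open>t\<close> occurs in \<open>R[x/t]\<close> unless \<open>x\<close> is not free
  in \<open>R\<close>, in which case \<open>R[x/t] = R\<close> whatever \<open>t\<close> is.)\<close>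

definition derivation ::
  "('f, 'p) signature \<Rightarrow> ('f, 'p) system \<Rightarrow> ('f, 'p) struct list \<Rightarrow> bool" where
  "derivation \<Sigma> \<S> \<Delta> \<longleftrightarrow> \<Delta> \<noteq> [] \<and> (\<forall>S\<in>set \<Delta>. wf_struct \<Sigma> S) \<and>
     successively (\<lambda>P Q. \<exists>\<rho>\<in>\<S>. rule_instance \<rho> P Q) \<Delta>"

text \<open>Premise and conclusion are taken up to equivalence, since equivalent structures are
  not distinguished.\<close>

definition has_derivation ::
  "('f, 'p) signature \<Rightarrow> ('f, 'p) system \<Rightarrow> ('f, 'p) struct \<Rightarrow> ('f, 'p) struct \<Rightarrow> bool" where
  "has_derivation \<Sigma> \<S> T R \<longleftrightarrow> (\<exists>\<Delta>. derivation \<Sigma> \<S> \<Delta> \<and> hd \<Delta> \<approx> T \<and> last \<Delta> \<approx> R)"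

definition strongly_equivalent ::
  "('f, 'p) signature \<Rightarrow> ('f, 'p) system \<Rightarrow> ('f, 'p) system \<Rightarrow> bool" where
  "strongly_equivalent \<Sigma> \<S> \<S>' \<longleftrightarrow>
     (\<forall>T R. wf_struct \<Sigma> T \<longrightarrow> wf_struct \<Sigma> R \<longrightarrow>
        (has_derivation \<Sigma> \<S> T R \<longleftrightarrow> has_derivation \<Sigma> \<S>' T R))"

end

theory Submission
  imports Defs
begin

text \<open>Each rule of one system is derivable in the other. The general identity, weakening and
  contraction rules reduce to their atomic forms by induction on the structure they are applied
  to, in negation normal form: medial moves contraction through conjunctions (and, dually,
  cocontraction through disjunctions), the \<open>l\<close>-rules move it through quantifiers, and the
  \<open>u\<close>-rules do the same for identity and cut. Conversely, medial and the \<open>l\<down>\<close>-rules are a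
  contraction of a structure into whose two copies the missing parts have been weakened;
  dually for the \<open>l\<up>\<close>-rules.\<close>

section \<open>Equivalence\<close>

declare equivalent.trans [trans]

lemma disj_equiv: "R \<approx> R' \<Longrightarrow> T \<approx> T' \<Longrightarrow> Disj [R, T] \<approx> Disj [R', T']"
  using equivalent.ctxt[of R R' "CDisj [] Hole [T]"] equivalent.ctxt[of T T' "CDisj [R'] Hole []"]
  by (auto intro: equivalent.trans)

lemma conj_equiv: "R \<approx> R' \<Longrightarrow> T \<approx> T' \<Longrightarrow> Conj [R, T] \<approx> Conj [R', T']"
  using equivalent.ctxt[of R R' "CConj [] Hole [T]"] equivalent.ctxt[of T T' "CConj [R'] Hole []"]
  by (auto intro: equivalent.trans)

text \<open>No equation removes a one-element list directly. Inserting the unit \<open>FF\<close>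
  below it creates a nested disjunction that can be flattened to two elements, where the unit law
  applies.\<close>

lemma disj_singleton: "Disj [R] \<approx> R"
proof -
  have "Disj [R] \<approx> Disj [Disj [FF, R]]"
    using equivalent.ctxt[OF equivalent.sym[OF equivalent.disj_FF], of "CDisj [] Hole []" R] by simp
  also have "\<dots> \<approx> Disj [FF, R]"
    using equivalent.disj_assoc[of "[FF, R]" "[]" "[]"] by simp
  also have "\<dots> \<approx> R" by (rule equivalent.disj_FF)
  finally show ?thesis .
qed

lemma conj_singleton: "Conj [R] \<approx> R"
proof -
  have "Conj [R] \<approx> Conj [Conj [TT, R]]"
    using equivalent.ctxt[OF equivalent.sym[OF equivalent.conj_TT], of "CConj [] Hole []" R] by simp
  also have "\<dots> \<approx> Conj [TT, R]"
    using equivalent.conj_assoc[of "[TT, R]" "[]" "[]"] by simp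
  also have "\<dots> \<approx> R" by (rule equivalent.conj_TT)
  finally show ?thesis .
qed

lemma disj_Cons: "Rs \<noteq> [] \<Longrightarrow> Disj (R # Rs) \<approx> Disj [R, Disj Rs]"
  using equivalent.disj_assoc[of Rs "[R]" "[]"] by (auto intro: equivalent.sym)

lemma conj_Cons: "Rs \<noteq> [] \<Longrightarrow> Conj (R # Rs) \<approx> Conj [R, Conj Rs]"
  using equivalent.conj_assoc[of Rs "[R]" "[]"] by (auto intro: equivalent.sym)

lemma disj_assoc2: "Disj [Disj [R, T], U] \<approx> Disj [R, Disj [T, U]]"
  using equivalent.disj_assoc[of "[R, T]" "[]" "[U]"] disj_Cons[of "[T, U]" R]
  by (auto intro: equivalent.trans)

lemma conj_assoc2: "Conj [Conj [R, T], U] \<approx> Conj [R, Conj [T, U]]"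
  using equivalent.conj_assoc[of "[R, T]" "[]" "[U]"] conj_Cons[of "[T, U]" R]
  by (auto intro: equivalent.trans)

text \<open>Regroups two copies of a disjunction by component, which is all that contraction of a
  disjunction needs.\<close>

lemma disj_interchange: "Disj [Disj [R, T], Disj [U, V]] \<approx> Disj [Disj [R, U], Disj [T, V]]"
proof -
  have "Disj [Disj [R, T], Disj [U, V]] \<approx> Disj [R, Disj [Disj [T, U], V]]"
    by (rule equivalent.trans[OF disj_assoc2 disj_equiv[OF equivalent.refl
        equivalent.sym[OF disj_assoc2]]])
  also have "\<dots> \<approx> Disj [R, Disj [Disj [U, T], V]]"
    by (intro disj_equiv equivalent.refl
        equivalent.disj_comm)
  also have "\<dots> \<approx> Disj [Disj [R, U], Disj [T, V]]"
    by (rule equivalent.sym[OF equivalent.trans[OF disj_assoc2 disj_equiv[OF equivalent.refl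
        equivalent.sym[OF disj_assoc2]]]])
  finally show ?thesis .
qed

lemma conj_interchange: "Conj [Conj [R, T], Conj [U, V]] \<approx> Conj [Conj [R, U], Conj [T, V]]"
proof -
  have "Conj [Conj [R, T], Conj [U, V]] \<approx> Conj [R, Conj [Conj [T, U], V]]"
    by (rule equivalent.trans[OF conj_assoc2 conj_equiv[OF equivalent.refl
        equivalent.sym[OF conj_assoc2]]])
  also have "\<dots> \<approx> Conj [R, Conj [Conj [U, T], V]]"
    by (intro conj_equiv equivalent.refl
        equivalent.conj_comm)
  also have "\<dots> \<approx> Conj [Conj [R, U], Conj [T, V]]"
    by (rule equivalent.sym[OF equivalent.trans[OF conj_assoc2 conj_equiv[OF equivalent.refl
        equivalent.sym[OF conj_assoc2]]]])
  finally show ?thesis .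
qed

lemma uni_TT: "Uni x TT \<approx> TT" and uni_FF: "Uni x FF \<approx> FF"
  and exi_TT: "Exi x TT \<approx> TT" and exi_FF: "Exi x FF \<approx> FF"
  by (auto intro: equivalent.vacuous_uni equivalent.vacuous_exi)

lemma disj_FF_right: "Disj [R, FF] \<approx> R"
  by (rule equivalent.trans[OF equivalent.disj_comm equivalent.disj_FF])

lemma conj_TT_right: "Conj [R, TT] \<approx> R"
  by (rule equivalent.trans[OF equivalent.conj_comm equivalent.conj_TT])

text \<open>Induction over negation normal forms without computing them: closure of \<open>P\<close>
  under equivalence allows lists to be split into binary connectives and negations to be pushed down
  to atoms, so no case for \<open>Neg\<close> remains.\<close>

lemma wf_struct_nnf_induct [consumes 1, case_names equiv FF TT atom Disj Conj Exi Uni]: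
  assumes "wf_struct \<Sigma> R"
    and P_equiv: "\<And>R T. wf_struct \<Sigma> R \<Longrightarrow> P R \<Longrightarrow> R \<approx> T \<Longrightarrow> P T"
    and P_FF: "P FF" and P_TT: "P TT"
    and P_atom: "\<And>a. is_atom a \<Longrightarrow> wf_struct \<Sigma> a \<Longrightarrow> P a"
    and P_Disj: "\<And>R T. wf_struct \<Sigma> R \<Longrightarrow> wf_struct \<Sigma> T \<Longrightarrow> P R \<Longrightarrow> P T \<Longrightarrow> P (Disj [R, T])"
    and P_Conj: "\<And>R T. wf_struct \<Sigma> R \<Longrightarrow> wf_struct \<Sigma> T \<Longrightarrow> P R \<Longrightarrow> P T \<Longrightarrow> P (Conj [R, T])"
    and P_Exi: "\<And>x R. wf_struct \<Sigma> R \<Longrightarrow> P R \<Longrightarrow> P (Exi x R)"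
    and P_Uni: "\<And>x R. wf_struct \<Sigma> R \<Longrightarrow> P R \<Longrightarrow> P (Uni x R)"
  shows "P R"
proof -
  \<comment> \<open>Carrying \<open>P\<close> for a structure and for its negation together makes
    structural induction go through: \<open>Neg\<close> merely exchanges the two halves, and each De
    Morgan law obtains one half from the dual case.\<close>
  define Q where "Q R \<longleftrightarrow> wf_struct \<Sigma> R \<and> P R \<and> P (Neg R)" for R
  have Q_equiv: "Q R" if "Q T" "R \<approx> T" for R T
    using that equivalent_wf[OF that(2), of \<Sigma>] unfolding Q_def
    by (metis P_equiv equivalent.neg equivalent.sym wf_struct.simps(6))
  have P_cong: "P R" if "P T" "R \<approx> T" "wf_struct \<Sigma> R" for R T
    using that equivalent_wf[OF that(2), of \<Sigma>] by (metis P_equiv equivalent.sym)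
  have Q_Disj: "Q (Disj [R, T])" if "Q R" "Q T" for R T
    using that unfolding Q_def by (auto intro: P_Disj P_cong[OF P_Conj equivalent.neg_disj])
  have Q_Conj: "Q (Conj [R, T])" if "Q R" "Q T" for R T
    using that unfolding Q_def by (auto intro: P_Conj P_cong[OF P_Disj equivalent.neg_conj])
  have Q_Disj_list: "Q (Disj Rs)" if "Rs \<noteq> []" "\<And>R. R \<in> set Rs \<Longrightarrow> Q R" for Rs
    using that
  proof (induction Rs rule: list_nonempty_induct)
    case (single R)
    then show ?case using Q_equiv[OF _ disj_singleton] by simp
  next
    case (cons R Rs)
    then show ?case using Q_equiv[OF Q_Disj disj_Cons] by simp
  qed
  have Q_Conj_list: "Q (Conj Rs)" if "Rs \<noteq> []" "\<And>R. R \<in> set Rs \<Longrightarrow> Q R" for Rs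
    using that
  proof (induction Rs rule: list_nonempty_induct)
    case (single R)
    then show ?case using Q_equiv[OF _ conj_singleton] by simp
  next
    case (cons R Rs)
    then show ?case using Q_equiv[OF Q_Conj conj_Cons] by simp
  qed
  have "wf_struct \<Sigma> R \<Longrightarrow> Q R"
  proof (induction R)
    case FF
    show ?case using P_cong[OF P_TT equivalent.neg_FF] P_FF by (simp add: Q_def)
  next
    case TT
    show ?case using P_cong[OF P_FF equivalent.neg_TT] P_TT by (simp add: Q_def)
  next
    case (Atm p ts)
    then show ?case
      \<comment> \<open>The negation of an atom is again an atom, so the atom case supplies both
        halves of \<open>Q\<close>.\<close>
      using P_atom[of "Atm p ts"] P_atom[of "Neg (Atm p ts)"] by (simp add: Q_def is_atom.intros)
  next
    case (Disj Rs)
    then show ?case by (auto intro: Q_Disj_list)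
  next
    case (Conj Rs)
    then show ?case by (auto intro: Q_Conj_list)
  next
    case (Neg R)
    then show ?case using P_cong[OF _ equivalent.neg_neg] by (simp add: Q_def)
  next
    case (Exi x R)
    then show ?case
      using P_Exi P_Uni[of "Neg R" x] P_cong[OF _ equivalent.neg_exi]
      by (simp add: Q_def)
  next
    case (Uni x R)
    then show ?case
      using P_Uni P_Exi[of "Neg R" x] P_cong[OF _ equivalent.neg_uni]
      by (simp add: Q_def)
  qed
  with assms(1) show ?thesis by (simp add: Q_def)
qed

section \<open>Derivability\<close>

text \<open>Inductive counterpart of \<open>has_derivation\<close>, growing downwards. Equivalence
  enters only in the base case, because \<open>rule_instance\<close> already absorbs it at premise
  and conclusion.\<close>

inductive derives ::
  "('f, 'p) signature \<Rightarrow> ('f, 'p) system \<Rightarrow> ('f, 'p) struct \<Rightarrow> ('f, 'p) struct \<Rightarrow> bool"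
  for \<Sigma> \<S> where
  equiv: "wf_struct \<Sigma> T \<Longrightarrow> T \<approx> R \<Longrightarrow> derives \<Sigma> \<S> T R"
| step: "derives \<Sigma> \<S> T U \<Longrightarrow> \<rho> \<in> \<S> \<Longrightarrow> rule_instance \<rho> U R \<Longrightarrow> wf_struct \<Sigma> R \<Longrightarrow> derives \<Sigma> \<S> T R"

lemma derives_wf: "derives \<Sigma> \<S> T R \<Longrightarrow> wf_struct \<Sigma> T \<and> wf_struct \<Sigma> R"
  by (induction rule: derives.induct) (auto dest: equivalent_wf)

lemma rule_instance_equiv:
  "P \<approx> P' \<Longrightarrow> rule_instance \<rho> P' Q \<Longrightarrow> rule_instance \<rho> P Q"
  "rule_instance \<rho> P Q \<Longrightarrow> Q \<approx> Q' \<Longrightarrow> rule_instance \<rho> P Q'"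
  unfolding rule_instance_def by (blast intro: equivalent.trans)+

lemma derives_equiv_left [trans]: "T \<approx> U \<Longrightarrow> derives \<Sigma> \<S> U R \<Longrightarrow> derives \<Sigma> \<S> T R"
  by (rotate_tac 1, induction rule: derives.induct)
    (auto intro: derives.intros equivalent.trans dest: equivalent_wf)

lemma derives_equiv_right [trans]: "derives \<Sigma> \<S> T U \<Longrightarrow> U \<approx> R \<Longrightarrow> derives \<Sigma> \<S> T R"
  by (induction rule: derives.induct)
    (metis derives.equiv equivalent.trans, metis derives.step rule_instance_equiv(2) equivalent_wf)

lemma derives_trans [trans]: "derives \<Sigma> \<S> T U \<Longrightarrow> derives \<Sigma> \<S> U R \<Longrightarrow> derives \<Sigma> \<S> T R"
  \<comment> \<open>Induction on the second derivation, whose steps are appended below the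
    first.\<close>
  by (rotate_tac 1, induction rule: derives.induct) (auto intro: derives_equiv_right derives.step)

lemma has_derivation_iff_derives:
  assumes "wf_struct \<Sigma> T"
  shows "has_derivation \<Sigma> \<S> T R \<longleftrightarrow> derives \<Sigma> \<S> T R"
proof
  assume "has_derivation \<Sigma> \<S> T R"
  then obtain \<Delta> where \<Delta>: "derivation \<Sigma> \<S> \<Delta>" "hd \<Delta> \<approx> T" "last \<Delta> \<approx> R"
    by (auto simp: has_derivation_def)
  have "\<Delta> \<noteq> []" using \<Delta>(1) by (simp add: derivation_def)
  then have "derivation \<Sigma> \<S> \<Delta> \<longrightarrow> derives \<Sigma> \<S> (hd \<Delta>) (last \<Delta>)"
  \<comment> \<open>The list is taken apart at its last entry, matching the downward growth of
    \<open>derives\<close>.\<close>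
  proof (induction \<Delta> rule: rev_nonempty_induct)
    case (single P)
    show ?case by (auto simp: derivation_def intro: derives.equiv equivalent.refl)
  next
    case (snoc Q \<Delta>)
    then show ?case
      by (auto simp: derivation_def successively_append_iff intro: derives.step)
  qed
  with \<Delta> show "derives \<Sigma> \<S> T R"
    by (blast intro: derives_equiv_left derives_equiv_right equivalent.sym)
next
  assume "derives \<Sigma> \<S> T R"
  then show "has_derivation \<Sigma> \<S> T R"
  proof induction
    case (equiv T R)
    \<comment> \<open>The derivation without rule instances suffices: its only entry
      \<open>T\<close> need only be equivalent to the conclusion \<open>R\<close>.\<close>
    then have "derivation \<Sigma> \<S> [T]" by (simp add: derivation_def)
    with equiv show ?case
      unfolding has_derivation_def by (metis equivalent.refl last.simps list.sel(1))
  next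
    case (step T U \<rho> R)
    then obtain \<Delta> where \<Delta>: "derivation \<Sigma> \<S> \<Delta>" "hd \<Delta> \<approx> T" "last \<Delta> \<approx> U"
      by (auto simp: has_derivation_def)
    with step have "derivation \<Sigma> \<S> (\<Delta> @ [R])"
      by (auto simp: derivation_def successively_append_iff intro: rule_instance_equiv)
    moreover have "hd (\<Delta> @ [R]) = hd \<Delta>"
      using \<Delta>(1) by (simp add: derivation_def)
    ultimately show ?case
      using \<Delta>(2) unfolding has_derivation_def by (metis equivalent.refl last_snoc)
  qed
qed

section \<open>Derivations inside contexts and simulation between systems\<close>

primrec comp_ctxt :: "('f, 'p) ctxt \<Rightarrow> ('f, 'p) ctxt \<Rightarrow> ('f, 'p) ctxt" where
  "comp_ctxt Hole S' = S'"
| "comp_ctxt (CDisj Us S Vs) S' = CDisj Us (comp_ctxt S S') Vs"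
| "comp_ctxt (CConj Us S Vs) S' = CConj Us (comp_ctxt S S') Vs"
| "comp_ctxt (CExi x S) S' = CExi x (comp_ctxt S S')"
| "comp_ctxt (CUni x S) S' = CUni x (comp_ctxt S S')"

lemma fill_comp_ctxt: "fill (comp_ctxt S S') R = fill S (fill S' R)"
  by (induction S) auto

lemma wf_fillD: "wf_struct \<Sigma> (fill S R) \<Longrightarrow> wf_struct \<Sigma> R"
  by (induction S) auto

lemma rule_instance_fill: "rule_instance \<rho> P Q \<Longrightarrow> rule_instance \<rho> (fill S P) (fill S Q)"
  unfolding rule_instance_def by (metis fill_comp_ctxt equivalent.ctxt)

text \<open>Deep inference: every rule instance survives in a larger context, by composing that
  context with its own, so a whole derivation does too.\<close>

lemma derives_fill:
  assumes "derives \<Sigma> \<S> T R" "wf_struct \<Sigma> (fill S T)"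
  shows "derives \<Sigma> \<S> (fill S T) (fill S R)"
  using assms
proof induction
  case (equiv T R)
  then show ?case by (blast intro: derives.equiv equivalent.ctxt)
next
  case (step T U \<rho> R)
  have "wf_struct \<Sigma> (fill S U)"
    using derives_wf[OF step.IH[OF step.prems]] by blast
  \<comment> \<open>Both sides are true here; the equation is the form in which
    \<open>wf_fill_cong\<close> transfers well-formedness from \<open>fill S U\<close> to
    \<open>fill S R\<close>.\<close>
  moreover have "wf_struct \<Sigma> U = wf_struct \<Sigma> R"
    using derives_wf[OF step.hyps(1)] step.hyps by blast
  ultimately have "wf_struct \<Sigma> (fill S R)"
    using wf_fill_cong by blast
  with step show ?case by (blast intro: derives.step rule_instance_fill)
qed

lemma derives_rule:
  assumes "(T, R) \<in> \<rho>" "\<rho> \<in> \<S>" "wf_struct \<Sigma> T" "wf_struct \<Sigma> R"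
  shows "derives \<Sigma> \<S> T R"
proof (rule derives.step)
  show "derives \<Sigma> \<S> T T" using assms(3) by (blast intro: derives.equiv equivalent.refl)
  show "rule_instance \<rho> T R"
    unfolding rule_instance_def using assms(1) by (metis fill.simps(1) equivalent.refl)
qed fact+

text \<open>Reduces the comparison of systems to the bare pairs of their rules: the context is
  restored by \<open>derives_fill\<close>, and well-formedness of a filled context passes to the
  structure in its hole.\<close>

lemma derives_simulation:
  assumes "derives \<Sigma> \<S> T R"
    and sim: "\<And>\<rho> p q. \<rho> \<in> \<S> \<Longrightarrow> (p, q) \<in> \<rho> \<Longrightarrow> wf_struct \<Sigma> p \<Longrightarrow> wf_struct \<Sigma> q \<Longrightarrow> derives \<Sigma> \<S>' p q"
  shows "derives \<Sigma> \<S>' T R"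
  using assms(1)
proof induction
  case (equiv T R)
  then show ?case by (rule derives.equiv)
next
  case (step T U \<rho> R)
  from \<open>rule_instance \<rho> U R\<close> obtain S p q
    where pq: "(p, q) \<in> \<rho>" and U: "U \<approx> fill S p" and R: "fill S q \<approx> R"
    by (auto simp: rule_instance_def)
  have wfp: "wf_struct \<Sigma> (fill S p)"
    using derives_wf[OF step.IH] equivalent_wf[OF U] by blast
  have "wf_struct \<Sigma> (fill S q)"
    using step.hyps(4) equivalent_wf[OF R] by blast
  with wfp pq have "derives \<Sigma> \<S>' p q"
    by (intro sim[OF step.hyps(2)]) (auto dest: wf_fillD)
  then have "derives \<Sigma> \<S>' (fill S p) (fill S q)"
    using wfp by (rule derives_fill)
  with step.IH U R show ?case
    by (blast intro: derives_trans derives_equiv_left derives_equiv_right)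
qed

text \<open>The system stays arbitrary and each lemma lists the rules it uses as members of it, so
  that the same lemma serves a full system and its down fragment.\<close>

context
  fixes \<Sigma> :: "('f, 'p) signature" and \<S> :: "('f, 'p) system"
begin

abbreviation wf where "wf \<equiv> wf_struct \<Sigma>"

abbreviation derives_in (infix "\<leadsto>" 50) where "T \<leadsto> R \<equiv> derives \<Sigma> \<S> T R"

lemma derives_refl: "wf R \<Longrightarrow> R \<leadsto> R"
  by (blast intro: derives.equiv equivalent.refl)

lemma derives_disj: "R \<leadsto> R' \<Longrightarrow> T \<leadsto> T' \<Longrightarrow> Disj [R, T] \<leadsto> Disj [R', T']"
  using derives_fill[of \<Sigma> \<S> R R' "CDisj [] Hole [T]"] derives_fill[of \<Sigma> \<S> T T' "CDisj [R'] Hole []"]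
  by (auto dest: derives_wf intro: derives_trans)

lemma derives_conj: "R \<leadsto> R' \<Longrightarrow> T \<leadsto> T' \<Longrightarrow> Conj [R, T] \<leadsto> Conj [R', T']"
  using derives_fill[of \<Sigma> \<S> R R' "CConj [] Hole [T]"] derives_fill[of \<Sigma> \<S> T T' "CConj [R'] Hole []"]
  by (auto dest: derives_wf intro: derives_trans)

lemma derives_exi: "R \<leadsto> T \<Longrightarrow> Exi x R \<leadsto> Exi x T"
  using derives_fill[of \<Sigma> \<S> R T "CExi x Hole"] by (auto dest: derives_wf)

lemma derives_uni: "R \<leadsto> T \<Longrightarrow> Uni x R \<leadsto> Uni x T"
  using derives_fill[of \<Sigma> \<S> R T "CUni x Hole"] by (auto dest: derives_wf)

lemma derives_switch:
  "s_rule \<in> \<S> \<Longrightarrow> wf R \<Longrightarrow> wf U \<Longrightarrow> wf T \<Longrightarrow> Conj [Disj [R, U], T] \<leadsto> Disj [Conj [R, T], U]"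
  by (rule derives_rule[of _ _ s_rule]) (auto simp: s_rule_def)

lemma derives_medial:
  "m_rule \<in> \<S> \<Longrightarrow> wf R \<Longrightarrow> wf U \<Longrightarrow> wf T \<Longrightarrow> wf V \<Longrightarrow>
    Disj [Conj [R, U], Conj [T, V]] \<leadsto> Conj [Disj [R, T], Disj [U, V]]"
  by (rule derives_rule[of _ _ m_rule]) (auto simp: m_rule_def)

section \<open>Reduction to atomic rules\<close>

text \<open>The two identities are put side by side in a conjunction, and two switches pull
  \<open>R'\<close> and \<open>T'\<close> out of it. Since \<open>R'\<close> and \<open>T'\<close>
  need not be written as negations, this covers both the conjunction and the disjunction case of
  identity.\<close>

lemma derives_identity_conj:
  assumes "s_rule \<in> \<S>" "TT \<leadsto> Disj [R, R']" "TT \<leadsto> Disj [T, T']"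
  shows "TT \<leadsto> Disj [Conj [R, T], Disj [R', T']]"
proof -
  have wf: "wf R" "wf R'" "wf T" "wf T'"
    using assms(2,3) by (auto dest: derives_wf)
  \<comment> \<open>Mirror image of the switch, which acts on a disjunction in the left
    conjunct.\<close>
  have s: "Conj [R, Disj [T, T']] \<leadsto> Disj [Conj [R, T], T']"
    by (rule derives_equiv_left[OF equivalent.conj_comm],
        rule derives_equiv_right[OF derives_switch])
      (use assms(1) wf in \<open>auto intro: disj_equiv equivalent.intros\<close>)
  have "TT \<approx> Conj [TT, TT]" by (blast intro: equivalent.sym equivalent.conj_TT)
  also have "Conj [TT, TT] \<leadsto> Conj [Disj [R, R'], Disj [T, T']]"
    using assms(2,3) by (rule derives_conj)
  also have "\<dots> \<leadsto> Disj [Conj [R, Disj [T, T']], R']"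
    using assms(1) wf by (intro derives_switch) auto
  also have "\<dots> \<leadsto> Disj [Disj [Conj [R, T], T'], R']"
    using s wf by (intro derives_disj derives_refl)
  also have "\<dots> \<approx> Disj [Conj [R, T], Disj [T', R']]"
    by (rule disj_assoc2)
  also have "\<dots> \<approx> Disj [Conj [R, T], Disj [R', T']]"
    by (intro disj_equiv equivalent.refl
        equivalent.disj_comm)
  finally show ?thesis .
qed

text \<open>After reassociation a switch brings \<open>R\<close> next to \<open>R'\<close>. Cutting
  this pair leaves \<open>FF\<close>, a unit of the disjunction, so \<open>T\<close> meets
  \<open>T'\<close> for the second cut.\<close>

lemma derives_cut_disj:
  assumes "s_rule \<in> \<S>" "Conj [R, R'] \<leadsto> FF" "Conj [T, T'] \<leadsto> FF"
  shows "Conj [Disj [R, T], Conj [R', T']] \<leadsto> FF"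
proof -
  have wf: "wf R" "wf R'" "wf T" "wf T'"
    using assms(2,3) by (auto dest: derives_wf)
  have "Conj [Disj [R, T], Conj [R', T']] \<approx> Conj [Conj [Disj [R, T], R'], T']"
    by (rule equivalent.sym[OF conj_assoc2])
  also have "\<dots> \<leadsto> Conj [Disj [Conj [R, R'], T], T']"
    using assms(1) wf by (intro derives_conj derives_switch derives_refl)
  also have "\<dots> \<leadsto> Conj [Disj [FF, T], T']"
    using assms(2) wf by (intro derives_conj derives_disj derives_refl)
  also have "\<dots> \<approx> Conj [T, T']"
    by (intro conj_equiv equivalent.refl
        equivalent.disj_FF)
  also have "Conj [T, T'] \<leadsto> FF" by fact
  finally show ?thesis .
qed

lemma identity_flip: "TT \<leadsto> Disj [R, T] \<Longrightarrow> TT \<leadsto> Disj [T, R]"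
  by (rule derives_equiv_right[OF _ equivalent.disj_comm])

lemma cut_flip: "Conj [R, T] \<leadsto> FF \<Longrightarrow> Conj [T, R] \<leadsto> FF"
  by (rule derives_equiv_left[OF equivalent.conj_comm])

text \<open>Vacuous quantification opens a universal scope around \<open>TT\<close>; the identity is
  created inside it and \<open>u_down\<close> splits the scope.\<close>

lemma derives_identity_uni:
  assumes "u_down \<in> \<S>" "TT \<leadsto> Disj [R, R']"
  shows "TT \<leadsto> Disj [Uni x R, Exi x R']"
proof -
  have "TT \<approx> Uni x TT" by (rule equivalent.sym[OF uni_TT])
  also have "\<dots> \<leadsto> Uni x (Disj [R, R'])" using assms(2) by (rule derives_uni)
  also have "\<dots> \<leadsto> Disj [Uni x R, Exi x R']"
    using assms by (intro derives_rule[of _ _ u_down]) (auto simp: u_down_def dest: derives_wf)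
  finally show ?thesis .
qed

lemma derives_cut_exi:
  assumes "u_up \<in> \<S>" "Conj [R, R'] \<leadsto> FF"
  shows "Conj [Exi x R, Uni x R'] \<leadsto> FF"
proof -
  have "Conj [Exi x R, Uni x R'] \<leadsto> Exi x (Conj [R, R'])"
    using assms by (intro derives_rule[of _ _ u_up]) (auto simp: u_up_def dest: derives_wf)
  also have "\<dots> \<leadsto> Exi x FF" using assms(2) by (rule derives_exi)
  also have "\<dots> \<approx> FF" by (rule exi_FF)
  finally show ?thesis .
qed

text \<open>By De Morgan the negation of a disjunction is a conjunction and that of an existential a
  universal. Those two cases are therefore the conjunction and universal ones with the two sides of
  the identity exchanged.\<close>

lemma derives_identity:
  assumes "{ai_down, s_rule, u_down} \<subseteq> \<S>" "wf R"
  shows "TT \<leadsto> Disj [R, Neg R]"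
  using assms(2)
proof (induction rule: wf_struct_nnf_induct)
  case (equiv R T)
  then show ?case by (blast intro: derives_equiv_right disj_equiv equivalent.neg)
next
  case FF
  show ?case
    by (rule derives.equiv)
      (simp, rule equivalent.sym[OF equivalent.trans[OF equivalent.disj_FF equivalent.neg_FF]])
next
  case TT
  show ?case
    by (rule derives.equiv)
      (simp, rule equivalent.sym[OF equivalent.trans[OF disj_equiv[OF equivalent.refl equivalent.neg_TT]
            disj_FF_right]])
next
  case (atom a)
  then show ?case
    using assms(1) by (intro derives_rule[of _ _ ai_down]) (auto simp: ai_down_def)
next
  case (Disj R T)
  have *: "TT \<leadsto> Disj [Conj [Neg R, Neg T], Disj [R, T]]"
    using Disj assms(1) by (intro derives_identity_conj[OF _ identity_flip identity_flip]) auto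
  show ?case
    by (rule derives_equiv_right[OF identity_flip[OF *]]) (intro disj_equiv equivalent.refl
        equivalent.sym[OF equivalent.neg_disj])
next
  case (Conj R T)
  have *: "TT \<leadsto> Disj [Conj [R, T], Disj [Neg R, Neg T]]"
    using Conj assms(1) by (intro derives_identity_conj) auto
  show ?case
    by (rule derives_equiv_right[OF *]) (intro disj_equiv equivalent.refl
        equivalent.sym[OF equivalent.neg_conj])
next
  case (Exi x R)
  have *: "TT \<leadsto> Disj [Uni x (Neg R), Exi x R]"
    using Exi assms(1) by (intro derives_identity_uni[OF _ identity_flip]) auto
  show ?case
    by (rule derives_equiv_right[OF identity_flip[OF *]]) (intro disj_equiv equivalent.refl
        equivalent.sym[OF equivalent.neg_exi])
next
  case (Uni x R)
  have *: "TT \<leadsto> Disj [Uni x R, Exi x (Neg R)]"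
    using Uni assms(1) by (intro derives_identity_uni) auto
  show ?case
    by (rule derives_equiv_right[OF *]) (intro disj_equiv equivalent.refl
        equivalent.sym[OF equivalent.neg_uni])
qed

text \<open>Dual to identity: conjunction and universal reduce to the disjunction and existential
  cases with the two sides of the cut exchanged.\<close>

lemma derives_cut:
  assumes "{ai_up, s_rule, u_up} \<subseteq> \<S>" "wf R"
  shows "Conj [R, Neg R] \<leadsto> FF"
  using assms(2)
proof (induction rule: wf_struct_nnf_induct)
  case (equiv R T)
  then show ?case by (blast intro: derives_equiv_left conj_equiv equivalent.neg equivalent.sym)
next
  case FF
  show ?case
    by (rule derives.equiv)
      (simp, rule equivalent.trans[OF conj_equiv[OF equivalent.refl
        equivalent.neg_FF] conj_TT_right])
next
  case TT
  show ?case
    by (rule derives.equiv) (simp, rule equivalent.trans[OF equivalent.conj_TT equivalent.neg_TT])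
next
  case (atom a)
  then show ?case
    using assms(1) by (intro derives_rule[of _ _ ai_up]) (auto simp: ai_up_def)
next
  case (Disj R T)
  have *: "Conj [Disj [R, T], Conj [Neg R, Neg T]] \<leadsto> FF"
    using Disj assms(1) by (intro derives_cut_disj) auto
  show ?case
    by (rule derives_equiv_left[OF _ *]) (intro conj_equiv equivalent.refl
        equivalent.neg_disj)
next
  case (Conj R T)
  have *: "Conj [Disj [Neg R, Neg T], Conj [R, T]] \<leadsto> FF"
    using Conj assms(1) by (intro derives_cut_disj[OF _ cut_flip cut_flip]) auto
  show ?case
    by (rule derives_equiv_left[OF _ cut_flip[OF *]]) (intro conj_equiv equivalent.refl
        equivalent.neg_conj)
next
  case (Exi x R)
  have *: "Conj [Exi x R, Uni x (Neg R)] \<leadsto> FF"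
    using Exi assms(1) by (intro derives_cut_exi) auto
  show ?case
    by (rule derives_equiv_left[OF _ *]) (intro conj_equiv equivalent.refl
        equivalent.neg_exi)
next
  case (Uni x R)
  have *: "Conj [Exi x (Neg R), Uni x R] \<leadsto> FF"
    using Uni assms(1) by (intro derives_cut_exi[OF _ cut_flip]) auto
  show ?case
    by (rule derives_equiv_left[OF _ cut_flip[OF *]]) (intro conj_equiv equivalent.refl
        equivalent.neg_uni)
qed

text \<open>Weakening \<open>TT\<close> from \<open>FF\<close>, and coweakening \<open>FF\<close> to
  \<open>TT\<close>, have no atomic instance, since units are not atoms. A switch on units alone
  achieves both.\<close>

lemma derives_FF_TT:
  assumes "s_rule \<in> \<S>"
  shows "FF \<leadsto> TT"
proof -
  have "FF \<approx> Conj [Disj [TT, TT], FF]"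
    by (rule equivalent.sym, rule equivalent.trans[OF conj_equiv equivalent.conj_TT])
      (rule equivalent.disj_TT equivalent.refl)+
  also have "\<dots> \<leadsto> Disj [Conj [TT, FF], TT]"
    using assms by (intro derives_switch) auto
  also have "\<dots> \<approx> TT"
    by (rule equivalent.trans[OF disj_equiv equivalent.disj_FF])
      (rule equivalent.conj_TT equivalent.refl)+
  finally show ?thesis .
qed

text \<open>\<open>FF\<close> is equivalent to a disjunction or conjunction of two copies of itself
  and to itself under any quantifier, so the components are weakened in separately.\<close>

lemma derives_weakening:
  assumes "{aw_down, s_rule} \<subseteq> \<S>" "wf R"
  shows "FF \<leadsto> R"
  using assms(2)
proof (induction rule: wf_struct_nnf_induct)
  case (equiv R T)
  then show ?case by (blast intro: derives_equiv_right)
next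
  case FF
  show ?case by (simp add: derives_refl)
next
  case TT
  show ?case using assms(1) by (simp add: derives_FF_TT)
next
  case (atom a)
  then show ?case
    using assms(1) by (intro derives_rule[of _ _ aw_down]) (auto simp: aw_down_def)
next
  case (Disj R T)
  then show ?case
    by (blast intro: derives_equiv_left[OF equivalent.sym[OF equivalent.disj_FF]] derives_disj)
next
  case (Conj R T)
  then show ?case
    by (blast intro: derives_equiv_left[OF equivalent.sym[OF equivalent.conj_FF]] derives_conj)
next
  case (Exi x R)
  then show ?case
    by (blast intro: derives_equiv_left[OF equivalent.sym[OF exi_FF]] derives_exi)
next
  case (Uni x R)
  then show ?case
    by (blast intro: derives_equiv_left[OF equivalent.sym[OF uni_FF]] derives_uni)
qed

text \<open>The components are reduced to \<open>TT\<close> separately, and the resulting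
  combination of units collapses to \<open>TT\<close>.\<close>

lemma derives_coweakening:
  assumes "{aw_up, s_rule} \<subseteq> \<S>" "wf R"
  shows "R \<leadsto> TT"
  using assms(2)
proof (induction rule: wf_struct_nnf_induct)
  case (equiv R T)
  then show ?case by (blast intro: derives_equiv_left equivalent.sym)
next
  case FF
  show ?case using assms(1) by (simp add: derives_FF_TT)
next
  case TT
  show ?case by (simp add: derives_refl)
next
  case (atom a)
  then show ?case
    using assms(1) by (intro derives_rule[of _ _ aw_up]) (auto simp: aw_up_def)
next
  case (Disj R T)
  then show ?case
    by (blast intro: derives_equiv_right[OF _ equivalent.disj_TT] derives_disj)
next
  case (Conj R T)
  then show ?case
    by (blast intro: derives_equiv_right[OF _ equivalent.conj_TT] derives_conj)
next
  case (Exi x R)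
  then show ?case
    by (blast intro: derives_equiv_right[OF _ exi_TT] derives_exi)
next
  case (Uni x R)
  then show ?case
    by (blast intro: derives_equiv_right[OF _ uni_TT] derives_uni)
qed

lemma derives_contraction:
  assumes "{ac_down, m_rule, l1_down, l2_down} \<subseteq> \<S>" "wf R"
  shows "Disj [R, R] \<leadsto> R"
  using assms(2)
proof (induction rule: wf_struct_nnf_induct)
  case (equiv R T)
  then show ?case
    by (meson derives_equiv_right derives_equiv_left disj_equiv equivalent.sym)
next
  case FF
  show ?case by (rule derives.equiv) (auto intro: equivalent.disj_FF)
next
  case TT
  show ?case by (rule derives.equiv) (auto intro: equivalent.disj_TT)
next
  case (atom a)
  then show ?case
    using assms(1) by (intro derives_rule[of _ _ ac_down]) (auto simp: ac_down_def)
next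
  case (Disj R T)
  then show ?case
    by (blast intro: derives_equiv_left[OF disj_interchange] derives_disj)
next
  case (Conj R T)
  have "Disj [Conj [R, T], Conj [R, T]] \<leadsto> Conj [Disj [R, R], Disj [T, T]]"
    using Conj assms(1) by (intro derives_medial) auto
  then show ?case using derives_trans derives_conj Conj.IH by blast
next
  case (Exi x R)
  have "Disj [Exi x R, Exi x R] \<leadsto> Exi x (Disj [R, R])"
    using Exi assms(1) by (intro derives_rule[of _ _ l1_down]) (auto simp: l1_down_def)
  then show ?case using derives_trans derives_exi Exi.IH by blast
next
  case (Uni x R)
  have "Disj [Uni x R, Uni x R] \<leadsto> Uni x (Disj [R, R])"
    using Uni assms(1) by (intro derives_rule[of _ _ l2_down]) (auto simp: l2_down_def)
  then show ?case using derives_trans derives_uni Uni.IH by blast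
qed

lemma derives_cocontraction:
  assumes "{ac_up, m_rule, l1_up, l2_up} \<subseteq> \<S>" "wf R"
  shows "R \<leadsto> Conj [R, R]"
  using assms(2)
proof (induction rule: wf_struct_nnf_induct)
  case (equiv R T)
  then show ?case
    by (meson derives_equiv_right derives_equiv_left conj_equiv equivalent.sym)
next
  case FF
  show ?case by (rule derives.equiv) (auto intro: equivalent.sym equivalent.conj_FF)
next
  case TT
  show ?case by (rule derives.equiv) (auto intro: equivalent.sym equivalent.conj_TT)
next
  case (atom a)
  then show ?case
    using assms(1) by (intro derives_rule[of _ _ ac_up]) (auto simp: ac_up_def)
next
  case (Disj R T)
  \<comment> \<open>Medial is its own dual: here it acts after the components have been duplicated,
    whereas in contraction it acts before they are merged.\<close>
  have "Disj [Conj [R, R], Conj [T, T]] \<leadsto> Conj [Disj [R, T], Disj [R, T]]"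
    using Disj assms(1) by (intro derives_medial) auto
  then show ?case using derives_trans derives_disj Disj.IH by blast
next
  case (Conj R T)
  then show ?case
    by (blast intro: derives_equiv_right[OF _ conj_interchange] derives_conj)
next
  case (Exi x R)
  have "Exi x (Conj [R, R]) \<leadsto> Conj [Exi x R, Exi x R]"
    using Exi assms(1) by (intro derives_rule[of _ _ l2_up]) (auto simp: l2_up_def)
  then show ?case using derives_trans derives_exi Exi.IH by blast
next
  case (Uni x R)
  have "Uni x (Conj [R, R]) \<leadsto> Conj [Uni x R, Uni x R]"
    using Uni assms(1) by (intro derives_rule[of _ _ l1_up]) (auto simp: l1_up_def)
  then show ?case using derives_trans derives_uni Uni.IH by blast
qed

section \<open>Derivability of medial and the quantifier rules\<close>

text \<open>With weakening and contraction, disjunction behaves as a join for derivability: this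
  lemma and the next are the injections, \<open>derives_disj_elim\<close> is the elimination.
  Conjunction is dually a meet, by coweakening and cocontraction.\<close>

lemma derives_disj_left:
  assumes "w_down \<in> \<S>" "wf R" "wf T"
  shows "R \<leadsto> Disj [R, T]"
proof -
  have "FF \<leadsto> T"
    using assms by (intro derives_rule[of _ _ w_down]) (auto simp: w_down_def)
  with assms show ?thesis
    by (blast intro: derives_equiv_left[OF equivalent.sym[OF disj_FF_right]] derives_disj derives_refl)
qed

lemma derives_disj_right:
  assumes "w_down \<in> \<S>" "wf R" "wf T"
  shows "T \<leadsto> Disj [R, T]"
  using derives_disj_left[OF assms(1,3,2)] equivalent.disj_comm by (rule derives_equiv_right)

lemma derives_conj_left:
  assumes "w_up \<in> \<S>" "wf R" "wf T"
  shows "Conj [R, T] \<leadsto> R"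
proof -
  have "T \<leadsto> TT"
    using assms by (intro derives_rule[of _ _ w_up]) (auto simp: w_up_def)
  with assms show ?thesis
    by (blast intro: derives_equiv_right[OF _ conj_TT_right] derives_conj derives_refl)
qed

lemma derives_conj_right:
  assumes "w_up \<in> \<S>" "wf R" "wf T"
  shows "Conj [R, T] \<leadsto> T"
  using equivalent.conj_comm derives_conj_left[OF assms(1,3,2)] by (rule derives_equiv_left)

lemma derives_disj_elim:
  assumes "c_down \<in> \<S>" "R \<leadsto> U" "T \<leadsto> U"
  shows "Disj [R, T] \<leadsto> U"
proof -
  have "Disj [U, U] \<leadsto> U"
    using assms by (intro derives_rule[of _ _ c_down]) (auto simp: c_down_def dest: derives_wf)
  with assms show ?thesis by (blast intro: derives_trans derives_disj)
qed

lemma derives_conj_intro: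
  assumes "c_up \<in> \<S>" "U \<leadsto> R" "U \<leadsto> T"
  shows "U \<leadsto> Conj [R, T]"
proof -
  have "U \<leadsto> Conj [U, U]"
    using assms by (intro derives_rule[of _ _ c_up]) (auto simp: c_up_def dest: derives_wf)
  with assms show ?thesis by (blast intro: derives_trans derives_conj)
qed

section \<open>Simulation of the rules of each system in the other\<close>

lemma derives_down_rules:
  assumes S: "{i_down, s_rule, w_down, c_down, u_down, n_down} \<subseteq> \<S>"
    and "\<rho> \<in> KSq" "(p, q) \<in> \<rho>" "wf p" "wf q"
  shows "p \<leadsto> q"
proof -
  have *: "p \<leadsto> q" if "\<rho> \<subseteq> \<rho>'" "\<rho>' \<in> \<S>" for \<rho>'
    using assms that by (blast intro: derives_rule)
  have sub: "ai_down \<subseteq> (i_down :: ('f, 'p) rule)" "aw_down \<subseteq> (w_down :: ('f, 'p) rule)"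
    "ac_down \<subseteq> (c_down :: ('f, 'p) rule)"
    by (auto simp: ai_down_def i_down_def aw_down_def w_down_def ac_down_def c_down_def)
  \<comment> \<open>Atomic rules are special cases of general ones, so an inclusion settles all but
    the last three.\<close>
  consider "\<rho> \<subseteq> i_down" | "\<rho> \<subseteq> s_rule" | "\<rho> \<subseteq> w_down" | "\<rho> \<subseteq> c_down" | "\<rho> \<subseteq> u_down"
    | "\<rho> \<subseteq> n_down" | "\<rho> = m_rule" | "\<rho> = l1_down" | "\<rho> = l2_down"
    using \<open>\<rho> \<in> KSq\<close> sub by (auto simp: KSq_def)
  then show ?thesis
  proof cases
    \<comment> \<open>Each disjunct of the premise reaches the conclusion by weakening inside both
      conjuncts; eliminating the disjunction contracts the two results. The \<open>l\<close>-rules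
      follow likewise under a quantifier.\<close>
    case 7
    with assms show ?thesis
      by (auto simp: m_rule_def
          intro!: derives_disj_elim derives_conj derives_disj_left derives_disj_right)
  next
    case 8
    with assms show ?thesis
      by (auto simp: l1_down_def
          intro!: derives_disj_elim derives_exi derives_disj_left derives_disj_right)
  next
    case 9
    with assms show ?thesis
      by (auto simp: l2_down_def
          intro!: derives_disj_elim derives_uni derives_disj_left derives_disj_right)
  qed (rule *, assumption, use S in simp)+
qed

text \<open>Covers what \<open>SKSq\<close> adds to \<open>KSq\<close>. Dually to the down case, the
  premise of an \<open>l\<close>-rule is duplicated and each copy is projected under the
  quantifier.\<close>

lemma derives_up_rules:
  assumes S: "{i_up, w_up, c_up, u_up, n_up} \<subseteq> \<S>"
    and "\<rho> \<in> {ai_up, aw_up, ac_up, u_up, l1_up, l2_up, n_up}" "(p, q) \<in> \<rho>" "wf p" "wf q"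
  shows "p \<leadsto> q"
proof -
  have *: "p \<leadsto> q" if "\<rho> \<subseteq> \<rho>'" "\<rho>' \<in> \<S>" for \<rho>'
    using assms that by (blast intro: derives_rule)
  have sub: "ai_up \<subseteq> (i_up :: ('f, 'p) rule)" "aw_up \<subseteq> (w_up :: ('f, 'p) rule)"
    "ac_up \<subseteq> (c_up :: ('f, 'p) rule)"
    by (auto simp: ai_up_def i_up_def aw_up_def w_up_def ac_up_def c_up_def)
  consider "\<rho> \<subseteq> i_up" | "\<rho> \<subseteq> w_up" | "\<rho> \<subseteq> c_up" | "\<rho> \<subseteq> u_up"
    | "\<rho> \<subseteq> n_up" | "\<rho> = l1_up" | "\<rho> = l2_up"
    using assms(2) sub by auto
  then show ?thesis
  proof cases
    case 6
    with assms show ?thesis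
      by (auto simp: l1_up_def
          intro!: derives_conj_intro derives_uni derives_conj_left derives_conj_right)
  next
    case 7
    with assms show ?thesis
      by (auto simp: l2_up_def
          intro!: derives_conj_intro derives_exi derives_conj_left derives_conj_right)
  qed (rule *, assumption, use S in simp)+
qed

lemma derives_general_down_rules:
  assumes S: "KSq \<subseteq> \<S>" and "\<rho> \<in> KSgq" "(p, q) \<in> \<rho>" "wf p" "wf q"
  shows "p \<leadsto> q"
proof -
  consider "\<rho> \<in> \<S>" | "\<rho> = i_down" | "\<rho> = w_down" | "\<rho> = c_down"
    using \<open>\<rho> \<in> KSgq\<close> S by (auto simp: KSq_def KSgq_def)
  then show ?thesis
  proof cases
    case 1
    with assms show ?thesis by (blast intro: derives_rule)
  qed (use assms in \<open>auto simp: KSq_def i_down_def w_down_def c_down_def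
        intro!: derives_identity derives_weakening derives_contraction\<close>)
qed

text \<open>All of \<open>SKSq\<close> is assumed because reducing cut and coweakening calls on
  switch, and reducing cocontraction on medial, both of which belong to the down fragment.\<close>

lemma derives_general_up_rules:
  assumes S: "SKSq \<subseteq> \<S>" and "\<rho> \<in> {i_up, w_up, c_up, u_up, n_up}" "(p, q) \<in> \<rho>" "wf p" "wf q"
  shows "p \<leadsto> q"
proof -
  consider "\<rho> \<in> \<S>" | "\<rho> = i_up" | "\<rho> = w_up" | "\<rho> = c_up"
    using assms(2) S by (auto simp: SKSq_def)
  then show ?thesis
  proof cases
    case 1
    with assms show ?thesis by (blast intro: derives_rule)
  qed (use assms in \<open>auto simp: SKSq_def i_up_def w_up_def c_up_def
        intro!: derives_cut derives_coweakening derives_cocontraction\<close>)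
qed

end

lemma strongly_equivalentI:
  assumes "\<And>\<rho> p q. \<rho> \<in> \<S> \<Longrightarrow> (p, q) \<in> \<rho> \<Longrightarrow> wf_struct \<Sigma> p \<Longrightarrow> wf_struct \<Sigma> q \<Longrightarrow> derives \<Sigma> \<S>' p q"
    and "\<And>\<rho> p q. \<rho> \<in> \<S>' \<Longrightarrow> (p, q) \<in> \<rho> \<Longrightarrow> wf_struct \<Sigma> p \<Longrightarrow> wf_struct \<Sigma> q \<Longrightarrow> derives \<Sigma> \<S> p q"
  shows "strongly_equivalent \<Sigma> \<S> \<S>'"
  unfolding strongly_equivalent_def
proof (intro allI impI)
  fix T R
  assume wf: "wf_struct \<Sigma> T"
  have "derives \<Sigma> \<S> T R \<longleftrightarrow> derives \<Sigma> \<S>' T R"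
    \<comment> \<open>One simulation for each direction.\<close>
    by (rule iffI; erule derives_simulation; rule assms)
  with wf show "has_derivation \<Sigma> \<S> T R \<longleftrightarrow> has_derivation \<Sigma> \<S>' T R"
    by (simp add: has_derivation_iff_derives)
qed

theorem theorem4p15:
  fixes \<Sigma> :: "('f, 'p) signature"
  shows "strongly_equivalent \<Sigma> SKSq SKSgq \<and> strongly_equivalent \<Sigma> KSq KSgq"
proof (intro conjI strongly_equivalentI)
  fix \<rho> p q
  assume pq: "(p, q) \<in> \<rho>" "wf_struct \<Sigma> p" "wf_struct \<Sigma> q"
  \<comment> \<open>Splitting off the down fragment lets the two simulations between
    \<open>KSq\<close> and \<open>KSgq\<close> be reused for the full systems.\<close>
  have SKSq: "SKSq = KSq \<union> {ai_up, aw_up, ac_up, u_up, l1_up, l2_up, n_up :: ('f, 'p) rule}"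
    by (auto simp: SKSq_def KSq_def)
  have SKSgq: "SKSgq = KSgq \<union> {i_up, w_up, c_up, u_up, n_up :: ('f, 'p) rule}"
    by (auto simp: SKSgq_def KSgq_def)
  show "derives \<Sigma> SKSgq p q" if "\<rho> \<in> SKSq"
    using that unfolding SKSq
  proof
    assume "\<rho> \<in> KSq"
    then show ?thesis by (rule derives_down_rules[OF _ _ pq, rotated]) (simp add: SKSgq_def)
  next
    assume "\<rho> \<in> {ai_up, aw_up, ac_up, u_up, l1_up, l2_up, n_up}"
    then show ?thesis by (rule derives_up_rules[OF _ _ pq, rotated]) (simp add: SKSgq_def)
  qed
  show "derives \<Sigma> SKSq p q" if "\<rho> \<in> SKSgq"
    using that unfolding SKSgq
  proof
    assume "\<rho> \<in> KSgq"
    then show ?thesis by (rule derives_general_down_rules[OF _ _ pq, rotated]) (auto simp: SKSq)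
  next
    assume "\<rho> \<in> {i_up, w_up, c_up, u_up, n_up}"
    from subset_refl this pq show ?thesis by (rule derives_general_up_rules)
  qed
  show "derives \<Sigma> KSgq p q" if "\<rho> \<in> KSq"
    by (rule derives_down_rules[OF _ that pq]) (simp add: KSgq_def)
  show "derives \<Sigma> KSq p q" if "\<rho> \<in> KSgq"
    by (rule derives_general_down_rules[OF subset_refl that pq])
qed

end
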